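(* Let $\delta,\tilde\delta\in(0,1)$ with $\tilde\delta<\delta$, let $k\in\mathbb{N}$, and let $0<\sigma<1/\log(\tilde\delta^{-1})$. Let $\alpha>0$ and let $M=M(N)$, $N\in\mathbb{N}$, be a positive-integer-valued function of $N$ with $M(N)=\omega(N^{\alpha})$. Then there is $\overline{N}\in\mathbb{N}$ such that for all $N\geq\overline{N}$ the following holds: for every family $(A_{\boldsymbol{m}})_{\boldsymbol{m}\in[M]^k}$ of sets $A_{\boldsymbol{m}}\subseteq[N]$ satisfying $|A_{\boldsymbol{m}}|\geq\delta N$ for each $\boldsymbol{m}\in[M]^k$, there are $B_1,\ldots,B_k\subseteq[M]$ with $|B_i|\geq(\sigma\log N)^{1/k}$ for each $i\in[k]$, such that $$\left|\bigcap_{\boldsymbol{m}\in B_1\times\cdots\times B_k}A_{\boldsymbol{m}}\right|\geq N^{1-\sigma\log(\tilde\delta^{-1})}.$$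
   Context: $\mathbb{N}=\{1,2,\ldots\}$, $[N]=\{1,\ldots,N\}$, and $\log$ is the natural logarithm. For eventually positive functions $f,g:\mathbb{N}\to\mathbb{R}$, $f(n)=\omega(g(n))$ means $f(n)/g(n)\to\infty$ as $n\to\infty$. *)

theory Defs
  imports Complex_Main "HOL-Library.FuncSet"
begin

text \<open>
  A tuple in $S^k$ is an extensional function in \<^term>\<open>{1..k::nat} \<rightarrow>\<^sub>E S\<close>, and
  the product $B_1 \times \cdots \times B_k$ is \<^term>\<open>\<Pi>\<^sub>E i\<in>{1..k::nat}. B i\<close>.
\<close>

end

theory Submission
  imports Defs "HOL-Real_Asymp.Real_Asymp"
begin

text \<open>
  The sets $A_m$ form a $(k+1)$-partite hypergraph on $[M]^k \times [N]$ of density at least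
  $\delta$, and the coordinates are removed one at a time. Averaging over the $n$-subsets of the
  last factor (with convexity) yields a set $B$ of size $n$ such that the pairs $(m', x)$ joined to
  all of $B$ have density at least $(d - n/M)^n$, where $d$ is the current density. After $j < k$
  steps $d$ is about $\delta^{n^j}$, which is $N^{-o(1)}$ when $n \approx (\sigma \log N)^{1/k}$;
  so the loss $n/M \le n N^{-\alpha}$ stays negligible, and the last step leaves about
  $\delta^{n^k} N$ points $x$.
\<close>

section \<open>Binomial and convexity estimates\<close>

text \<open>The right side is the falling factorial d (d - 1) ... (d - n + 1), each of whose n
  factors is at least d - n. The subtraction is truncated, so for d < n the left side is 0.\<close>

lemma diff_power_le_ffact:
  "real (d - n) ^ n \<le> fact n * real (d choose n)"
proof (cases "n \<le> d")
  case True
  have "real (d - n) ^ n = (\<Prod>i<n. real (d - n))" by simp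
  also have "\<dots> \<le> (\<Prod>i<n. real (d - i))" by (intro prod_mono) auto
  also have "\<dots> = (\<Prod>i<n. real d - real i)"
    using True by (intro prod.cong) (auto simp: of_nat_diff)
  also have "\<dots> = fact n * real (d choose n)"
    by (simp add: binomial_gbinomial gbinomial_prod_rev atLeast0LessThan)
  finally show ?thesis .
next
  case False
  then show ?thesis by (cases n) auto
qed

text \<open>By convexity the graph of x^n lies above its tangent at c; this is Bernoulli's
  inequality for a / c - 1 >= -1, scaled by c^n. Writing the slope as n c^n / c avoids the exponent
  n - 1.\<close>

lemma power_tangent_le:
  fixes a c :: real
  assumes "0 < c" "0 \<le> a"
  shows "c ^ n + (a - c) * (real n * c ^ n / c) \<le> a ^ n"
proof -
  have "1 + real n * (a / c - 1) \<le> (1 + (a / c - 1)) ^ n"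
    using assms by (intro Bernoulli_inequality) auto
  then have "(1 + real n * (a / c - 1)) * c ^ n \<le> (a / c) ^ n * c ^ n"
    using assms by (intro mult_right_mono) auto
  also have "\<dots> = a ^ n" using assms by (simp add: power_divide)
  finally show ?thesis using assms by (simp add: field_simps)
qed

section \<open>Averaging over the n-subsets of one factor\<close>

text \<open>Double counting of the pairs (i, B) with B an n-subset of the neighbourhood of i:
  convexity gives at least |I| (c |V|)^n / n! pairs, while there are at most |V|^n / n! sets B, so
  some B reaches the average. The extra \<open>real n\<close> in the density pays for bounding the
  falling factorial of a degree d by (d - n)^n.\<close>

lemma dense_relation_common_neighbourhood:
  fixes R :: "'i \<Rightarrow> 'v \<Rightarrow> bool" and c :: real
  assumes I: "finite I" "I \<noteq> {}" and V: "finite V" "V \<noteq> {}" and c: "0 < c"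
    and dens: "(c * card V + real n) * real (card I) \<le> (\<Sum>i\<in>I. real (card {v\<in>V. R i v}))"
  shows "\<exists>B\<subseteq>V. card B = n \<and> c ^ n * real (card I) \<le> real (card {i\<in>I. \<forall>v\<in>B. R i v})"
proof -
  define M where "M = card V"
  define deg where "deg i = card {v\<in>V. R i v}" for i
  define F where "F = {B. B \<subseteq> V \<and> card B = n}"
  \<comment> \<open>The slope of x^n at x = c M, where c M is a lower bound for the average of deg i
    - n. The tangent terms therefore have a nonnegative sum over i.\<close>
  define T where "T = real n * (c * M) ^ n / (c * M)"
  have M: "M > 0" using V by (simp add: M_def card_gt_0_iff)
  have fin: "finite F" using V by (simp add: F_def)
  have cF: "card F = M choose n" using V by (simp add: F_def M_def n_subsets)
  have "real (card I) * (c * M) ^ n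
      \<le> (\<Sum>i\<in>I. (c * M) ^ n + (real (deg i) - n - c * M) * T)"
  proof -
    have "real (card I) * (n + c * M) \<le> (\<Sum>i\<in>I. real (deg i))"
      using dens by (simp add: M_def[symmetric] deg_def algebra_simps)
    then have "0 \<le> (\<Sum>i\<in>I. real (deg i) - n - c * M)"
      by (simp add: sum_subtractf algebra_simps)
    then have "0 \<le> (\<Sum>i\<in>I. real (deg i) - n - c * M) * T"
      using c M by (simp add: T_def)
    then show ?thesis by (simp add: sum.distrib sum_distrib_right)
  qed
  also have "\<dots> \<le> (\<Sum>i\<in>I. fact n * real (deg i choose n))"
  proof (rule sum_mono)
    fix i
    \<comment> \<open>Truncated subtraction can only increase the value, and \<open>T\<close> is
      nonnegative.\<close>
    have "(real (deg i) - n - c * M) * T \<le> (real (deg i - n) - c * M) * T"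
      using c M by (intro mult_right_mono) (auto simp: T_def)
    moreover have "(c * M) ^ n + (real (deg i - n) - c * M) * T \<le> real (deg i - n) ^ n"
      unfolding T_def using c M power_tangent_le[of "c * M" "real (deg i - n)" n] by simp
    ultimately show "(c * M) ^ n + (real (deg i) - n - c * M) * T \<le> fact n * real (deg i choose n)"
      using diff_power_le_ffact[of "deg i" n] by linarith
  qed
  also have "\<dots> = fact n * (\<Sum>i\<in>I. real (card {B\<in>F. \<forall>v\<in>B. R i v}))"
  proof -
    have "deg i choose n = card {B\<in>F. \<forall>v\<in>B. R i v}" for i
    proof -
      have "{B\<in>F. \<forall>v\<in>B. R i v} = {B. B \<subseteq> {v\<in>V. R i v} \<and> card B = n}"
        by (auto simp: F_def)
      then show ?thesis using V by (simp add: deg_def n_subsets)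
    qed
    then show ?thesis by (simp add: sum_distrib_left)
  qed
  also have "(\<Sum>i\<in>I. real (card {B\<in>F. \<forall>v\<in>B. R i v}))
      = (\<Sum>B\<in>F. real (card {i\<in>I. \<forall>v\<in>B. R i v}))"
    using sum_multicount_gen[OF I(1) fin, of "\<lambda>i B. \<forall>v\<in>B. R i v"
        "\<lambda>B. card {i\<in>I. \<forall>v\<in>B. R i v}"]
    by (simp flip: of_nat_sum)
  finally have lower: "real (card I) * (c * M) ^ n
      \<le> fact n * (\<Sum>B\<in>F. real (card {i\<in>I. \<forall>v\<in>B. R i v}))" .
  show ?thesis
  proof (rule ccontr)
    assume "\<not> ?thesis"
    then have small: "real (card {i\<in>I. \<forall>v\<in>B. R i v}) < c ^ n * card I" if "B \<in> F" for B
      using that by (force simp: F_def not_le)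
    \<comment> \<open>Positivity of the lower bound shows that n-subsets of V exist at all, which
      the strict comparison of sums needs.\<close>
    have pos: "0 < real (card I) * (c * M) ^ n"
      using I c M by (simp add: card_gt_0_iff)
    with lower have "F \<noteq> {}" by auto
    then have "(\<Sum>B\<in>F. real (card {i\<in>I. \<forall>v\<in>B. R i v})) < (\<Sum>B\<in>F. c ^ n * card I)"
      using small fin by (intro sum_strict_mono) auto
    then have "real (card I) * (c * M) ^ n < (fact n * real (M choose n)) * (c ^ n * card I)"
      using lower by (simp add: cF mult.assoc) (smt (verit) fact_gt_zero mult_strict_left_mono)
    also have "\<dots> \<le> real M ^ n * (c ^ n * card I)"
    proof (rule mult_right_mono)
      have "fact n * (M choose n) \<le> M ^ n"
        by (metis binomial_fact_pow mult.commute)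
      then have "real (fact n * (M choose n)) \<le> real (M ^ n)" by (rule of_nat_mono)
      then show "fact n * real (M choose n) \<le> real M ^ n" by simp
    qed (use c in auto)
    finally show False by (simp add: power_mult_distrib)
  qed
qed

section \<open>Removing the coordinates one at a time\<close>

lemma PiE_atLeastAtMost_Suc:
  "(\<Pi>\<^sub>E i\<in>{1..Suc k}. B i) = (\<lambda>(m, v). m(Suc k := v)) ` ((\<Pi>\<^sub>E i\<in>{1..k}. B i) \<times> B (Suc k))"
  by (simp add: atLeastAtMostSuc_conv PiE_insert_eq) (force simp: image_iff)

text \<open>
  The slack factor $1 + s$ is kept through the induction: the loss $n/M$ may lower it to
  $1 + s/2$, but $(1 + s/2)^n \ge 1 + s$ since $n \ge 2$.
\<close>

lemma dense_hypergraph_common_points: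
  fixes E :: "(nat \<Rightarrow> nat) \<Rightarrow> 'x \<Rightarrow> bool"
  assumes X: "finite X" "X \<noteq> {}" and V: "finite V" "V \<noteq> {}" and n: "2 \<le> n"
    and st: "0 < s" "0 < t" "t \<le> 1"
    and small: "\<And>j. j < k \<Longrightarrow> real n / card V \<le> s / 2 * t ^ (n ^ j)"
    and dens: "t * (1 + s) * real (card V) ^ k * card X
      \<le> (\<Sum>m\<in>{1..k} \<rightarrow>\<^sub>E V. real (card {x\<in>X. E m x}))"
  shows "\<exists>B. (\<forall>i\<in>{1..k}. B i \<subseteq> V \<and> card (B i) = n) \<and>
    t ^ (n ^ k) * card X \<le> real (card {x\<in>X. \<forall>m\<in>(\<Pi>\<^sub>E i\<in>{1..k}. B i). E m x})"
  using st(2,3) small dens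
proof (induction k arbitrary: t E)
  case 0
  have "t * card X \<le> t * (1 + s) * card X"
    using st 0 by (intro mult_right_mono) auto
  also have "\<dots> \<le> real (card {x\<in>X. E (\<lambda>_. undefined) x})" using 0 by simp
  finally show ?case by simp
next
  case (Suc k)
  define P where "P = {1..k} \<rightarrow>\<^sub>E V"
  \<comment> \<open>The last coordinate is set against all the others: a pair (m, x) is related to v
    if appending v to m gives an edge at x. The constant \<open>c\<close> keeps half of the slack
    \<open>s\<close>.\<close>
  define I where "I = P \<times> X"
  define R where "R = (\<lambda>(m, x) v. E (m(Suc k := v)) x)"
  define c where "c = t * (1 + s / 2)"
  have P: "finite P" "card P = card V ^ k" "P \<noteq> {}"
    using V by (auto simp: P_def card_PiE PiE_eq_empty_iff finite_PiE)
  have I: "finite I" "I \<noteq> {}" "card I = card V ^ k * card X"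
    using P X by (auto simp: I_def)
  have c: "0 < c" using st Suc by (simp add: c_def)
  \<comment> \<open>Tuples in \<open>P\<close> are extensional, hence \<open>undefined\<close> at
    Suc k, so overwriting that position loses no information.\<close>
  have inj: "inj_on (\<lambda>(m, v). m(Suc k := v)) (P \<times> V)"
    unfolding P_def inj_on_def
    by (auto simp: fun_eq_iff PiE_iff extensional_def split: if_splits)
  have "(\<Sum>m\<in>{1..Suc k} \<rightarrow>\<^sub>E V. real (card {x\<in>X. E m x}))
      = (\<Sum>(m, v)\<in>P \<times> V. real (card {x\<in>X. E (m(Suc k := v)) x}))"
    unfolding PiE_atLeastAtMost_Suc P_def[symmetric]
    by (subst sum.reindex[OF inj]) (simp add: case_prod_unfold)
  also have "\<dots> = (\<Sum>m\<in>P. \<Sum>v\<in>V. real (card {x\<in>X. E (m(Suc k := v)) x}))"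
    by (simp add: sum.cartesian_product)
  also have "\<dots> = (\<Sum>m\<in>P. \<Sum>x\<in>X. real (card {v\<in>V. E (m(Suc k := v)) x}))"
    using sum_multicount_gen[OF V(1) X(1)]
    by (intro sum.cong refl) (simp flip: of_nat_sum)
  also have "\<dots> = (\<Sum>i\<in>I. real (card {v\<in>V. R i v}))"
    by (simp add: I_def R_def sum.cartesian_product case_prod_unfold)
  finally have sumI: "(\<Sum>m\<in>{1..Suc k} \<rightarrow>\<^sub>E V. real (card {x\<in>X. E m x}))
      = (\<Sum>i\<in>I. real (card {v\<in>V. R i v}))" .
  \<comment> \<open>For j = 0 the smallness hypothesis says that the loss n / |V| is covered by the
    other half of the slack.\<close>
  have "real n / card V \<le> s / 2 * t" using Suc.prems(3)[of 0] by simp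
  moreover have "c = t + s / 2 * t" "t * (1 + s) = t + s / 2 * t + s / 2 * t"
    by (simp_all add: c_def algebra_simps)
  ultimately have "c + real n / card V \<le> t * (1 + s)" by linarith
  then have "(c + real n / card V) * card V * card I \<le> t * (1 + s) * card V * card I"
    by (intro mult_right_mono) auto
  then have "(c * card V + n) * card I \<le> t * (1 + s) * card V * card I"
    using V by (simp add: distrib_right card_gt_0_iff)
  also have "\<dots> \<le> (\<Sum>i\<in>I. real (card {v\<in>V. R i v}))"
    using Suc.prems(4) unfolding sumI by (simp add: I mult_ac)
  finally obtain B0 where B0: "B0 \<subseteq> V" "card B0 = n"
      "c ^ n * card I \<le> card {i\<in>I. \<forall>v\<in>B0. R i v}"
    using dense_relation_common_neighbourhood[OF I(1,2) V c] by blast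
  \<comment> \<open>The hypergraph on the first k coordinates whose edges extend by every element of
    \<open>B0\<close>. The induction hypothesis is applied to it with t^n in place of t.\<close>
  define E' where "E' m x \<longleftrightarrow> (\<forall>v\<in>B0. E (m(Suc k := v)) x)" for m x
  have "1 + s \<le> 1 + n * (s / 2)" using n st by (simp add: field_simps)
  also have "\<dots> \<le> (1 + s / 2) ^ n" using st by (intro Bernoulli_inequality) auto
  finally have "t ^ n * (1 + s) \<le> c ^ n"
    using Suc.prems by (simp add: c_def power_mult_distrib)
  then have "t ^ n * (1 + s) * card I \<le> c ^ n * card I" by (intro mult_right_mono) auto
  also note B0(3)
  also have "{i\<in>I. \<forall>v\<in>B0. R i v} = (SIGMA m:P. {x\<in>X. E' m x})"
    by (auto simp: I_def R_def E'_def)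
  also have "card \<dots> = (\<Sum>m\<in>P. card {x\<in>X. E' m x})"
    using P X by (subst card_SigmaI) auto
  finally have dens': "t ^ n * (1 + s) * real (card V) ^ k * card X
      \<le> (\<Sum>m\<in>{1..k} \<rightarrow>\<^sub>E V. real (card {x\<in>X. E' m x}))"
    by (simp add: I P_def mult.assoc)
  \<comment> \<open>Since (t^n)^(n^j) = t^(n^(j+1)), the index of the smallness hypothesis shifts by
    one.\<close>
  have small': "real n / card V \<le> s / 2 * (t ^ n) ^ (n ^ j)" if "j < k" for j
    using Suc.prems(3)[of "Suc j"] that by (simp flip: power_mult)
  obtain B where B: "\<forall>i\<in>{1..k}. B i \<subseteq> V \<and> card (B i) = n"
      "(t ^ n) ^ (n ^ k) * card X \<le> card {x\<in>X. \<forall>m\<in>(\<Pi>\<^sub>E i\<in>{1..k}. B i). E' m x}"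
    using Suc.IH[OF _ _ small' dens'] Suc.prems(1,2) by (auto simp: power_le_one)
  let ?B = "B(Suc k := B0)"
  have PiE_B: "(\<Pi>\<^sub>E i\<in>{1..k}. ?B i) = (\<Pi>\<^sub>E i\<in>{1..k}. B i)" by (intro PiE_cong) auto
  have "{x\<in>X. \<forall>m\<in>(\<Pi>\<^sub>E i\<in>{1..k}. B i). E' m x}
      = {x\<in>X. \<forall>m\<in>(\<Pi>\<^sub>E i\<in>{1..Suc k}. ?B i). E m x}"
    unfolding PiE_atLeastAtMost_Suc PiE_B by (auto simp: E'_def)
  with B B0 show ?case
    by (intro exI[of _ ?B]) (auto simp: le_Suc_eq simp flip: power_mult)
qed

section \<open>Asymptotic estimates\<close>

text \<open>The ratio (y + 1) / y tends to 1, so the gap between a and b absorbs the cost of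
  rounding y up to an integer.\<close>

lemma eventually_shifted_power_le:
  fixes a b :: real
  assumes "0 < b" "a < b"
  shows "\<forall>\<^sub>F y in at_top. a * (y + 1) ^ k \<le> b * y ^ k"
proof -
  have "((\<lambda>y::real. (y + 1) / y) \<longlongrightarrow> 1) at_top" by real_asymp
  then have "((\<lambda>y::real. a * ((y + 1) / y) ^ k) \<longlongrightarrow> a * 1 ^ k) at_top"
    by (intro tendsto_intros)
  then have "\<forall>\<^sub>F y in at_top. a * ((y + 1) / y) ^ k < b"
    by (rule order_tendstoD(2)) (use assms in simp)
  then show ?thesis
    using eventually_gt_at_top[of 0]
    by eventually_elim (simp add: power_divide field_simps)
qed

text \<open>The exponent on the right has the higher degree in y. After taking logarithms and
  dividing by y^(k+1), the claim follows from L y < b, where \<open>L\<close> tends to 0. It serves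
  to bound the loss n / M.\<close>

lemma eventually_exp_shifted_power_le:
  fixes a b c :: real
  assumes "0 < b" "0 < c"
  shows "\<forall>\<^sub>F y in at_top. (y + 1) * exp (a * (y + 1) ^ k) \<le> c * exp (b * y ^ Suc k)"
proof -
  define L where "L y = (ln (y + 1) - ln c) / y * (1 / y) ^ k + a * ((y + 1) / y) ^ k * (1 / y)"
    for y :: real
  have "((\<lambda>y::real. (ln (y + 1) - ln c) / y) \<longlongrightarrow> 0) at_top"
    "((\<lambda>y::real. (y + 1) / y) \<longlongrightarrow> 1) at_top" "((\<lambda>y::real. 1 / y) \<longlongrightarrow> 0) at_top"
    by real_asymp+
  then have "(L \<longlongrightarrow> 0 * 0 ^ k + a * 1 ^ k * 0) at_top"
    unfolding L_def by (intro tendsto_intros)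
  then have "\<forall>\<^sub>F y in at_top. L y < b"
    by (rule order_tendstoD(2)) (use assms in simp)
  then show ?thesis
    using eventually_gt_at_top[of 0]
  proof eventually_elim
    case (elim y)
    have "L y * y ^ Suc k = ln (y + 1) - ln c + a * (y + 1) ^ k"
      using elim by (simp add: L_def power_divide field_simps)
    moreover have "L y * y ^ Suc k \<le> b * y ^ Suc k"
      using elim by (intro mult_right_mono) auto
    ultimately have "ln (y + 1) + a * (y + 1) ^ k \<le> ln c + b * y ^ Suc k" by simp
    then have "exp (ln (y + 1) + a * (y + 1) ^ k) \<le> exp (ln c + b * y ^ Suc k)" by simp
    then show ?case using elim assms by (simp add: exp_add)
  qed
qed

section \<open>Choice of parameters and conclusion\<close>

theorem theorem4p1:
  fixes \<delta> \<delta>' \<sigma> \<alpha> :: real and k :: nat and M :: "nat \<Rightarrow> nat"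
  assumes "0 < \<delta>" and "\<delta> < 1" and "0 < \<delta>'" and "\<delta>' < 1" and "\<delta>' < \<delta>"
    and "k \<ge> 1"
    and "0 < \<sigma>" and "\<sigma> < 1 / ln (inverse \<delta>')"
    and "\<alpha> > 0"
    and "\<And>N. N \<ge> 1 \<Longrightarrow> M N \<ge> 1"
    and "filterlim (\<lambda>N. real (M N) / real N powr \<alpha>) at_top sequentially"
  shows "\<exists>N0\<ge>1. \<forall>N\<ge>N0. \<forall>A :: (nat \<Rightarrow> nat) \<Rightarrow> nat set.
    (\<forall>m \<in> {1..k} \<rightarrow>\<^sub>E {1..M N}. A m \<subseteq> {1..N} \<and> real (card (A m)) \<ge> \<delta> * real N) \<longrightarrow>
    (\<exists>B :: nat \<Rightarrow> nat set.
      (\<forall>i \<in> {1..k}. B i \<subseteq> {1..M N} \<and>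
         real (card (B i)) \<ge> (\<sigma> * ln (real N)) powr (1 / real k)) \<and>
      real (card (\<Inter>m \<in> (\<Pi>\<^sub>E i\<in>{1..k}. B i). A m))
        \<ge> real N powr (1 - \<sigma> * ln (inverse \<delta>')))"
proof -
  \<comment> \<open>The midpoint leaves room on both sides: t < \<delta> yields the slack
    \<open>s\<close>, and \<delta>' < t yields a < b, which absorbs the rounding of
    \<open>y N\<close>.\<close>
  define t where "t = (\<delta> + \<delta>') / 2"
  define s where "s = \<delta> / t - 1"
  define a where "a = ln (inverse t)"
  define b where "b = ln (inverse \<delta>')"
  define y where "y N = (\<sigma> * ln (real N)) powr (1 / real k)" for N :: nat
  have t: "0 < t" "t < \<delta>" "\<delta>' < t" "t < 1" using assms(1-5) by (auto simp: t_def)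
  have s: "0 < s" "t * (1 + s) = \<delta>" using t by (auto simp: s_def)
  have ab: "0 < a" "a < b" using t assms(3,4) by (auto simp: a_def b_def ln_inverse)
  have t_eq: "t = exp (- a)" using t by (simp add: a_def ln_inverse)
  have ytop: "filterlim y at_top sequentially"
  proof -
    have "filterlim (\<lambda>N::nat. \<sigma> * ln (real N)) at_top sequentially"
      using assms(7) by real_asymp
    moreover have "filterlim (\<lambda>x::real. x powr (1 / real k)) at_top at_top"
      using assms(6) by real_asymp
    ultimately show ?thesis
      unfolding y_def by (rule filterlim_compose[rotated])
  qed
  have "\<forall>\<^sub>F N in sequentially. 2 \<le> N"
    by (rule eventually_ge_at_top)
  moreover have "\<forall>\<^sub>F N in sequentially. 2 \<le> y N"
    using ytop by (simp add: filterlim_at_top)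
  moreover have "\<forall>\<^sub>F N in sequentially. 1 \<le> real (M N) / real N powr \<alpha>"
    using assms(11) by (simp add: filterlim_at_top)
  moreover have "\<forall>\<^sub>F N in sequentially. a * (y N + 1) ^ k \<le> b * y N ^ k"
    using eventually_compose_filterlim[OF eventually_shifted_power_le ytop] ab by simp
  \<comment> \<open>As \<open>y N ^ k\<close> will equal \<sigma> ln N and Suc (k - 1) = k, the
    exponential on the right is N^\<alpha>, eventually at most M N. This gives the smallness
    condition for j = k - 1.\<close>
  moreover have "\<forall>\<^sub>F N in sequentially.
      (y N + 1) * exp (a * (y N + 1) ^ (k - 1)) \<le> s / 2 * exp (\<alpha> / \<sigma> * y N ^ Suc (k - 1))"
    by (rule eventually_compose_filterlim[OF eventually_exp_shifted_power_le ytop])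
      (use s assms(7,9) in simp_all)
  ultimately have "\<forall>\<^sub>F N in sequentially. \<forall>A :: (nat \<Rightarrow> nat) \<Rightarrow> nat set.
    (\<forall>m \<in> {1..k} \<rightarrow>\<^sub>E {1..M N}. A m \<subseteq> {1..N} \<and> real (card (A m)) \<ge> \<delta> * real N) \<longrightarrow>
    (\<exists>B :: nat \<Rightarrow> nat set. (\<forall>i \<in> {1..k}. B i \<subseteq> {1..M N} \<and> real (card (B i)) \<ge> y N) \<and>
      real (card (\<Inter>m \<in> (\<Pi>\<^sub>E i\<in>{1..k}. B i). A m)) \<ge> real N powr (1 - \<sigma> * b))"
  proof eventually_elim
    case (elim N)
    define n where "n = nat \<lceil>y N\<rceil>"
    have n: "y N \<le> n" "real n \<le> y N + 1" "2 \<le> n"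
      using elim(2) unfolding n_def by linarith+
    have lnN: "0 < ln (real N)" using elim(1) by simp
    have yk: "y N ^ k = \<sigma> * ln (real N)"
      using lnN assms(6,7) by (simp add: y_def powr_powr flip: powr_realpow)
    have MN: "real N powr \<alpha> \<le> M N" "0 < M N"
      using elim(1,3) assms(10)[of N] by (auto simp: field_simps)
    have small: "real n / card {1..M N} \<le> s / 2 * t ^ (n ^ j)" if "j < k" for j
    proof -
      have "real n * exp (a * real n ^ (k - 1)) \<le> (y N + 1) * exp (a * (y N + 1) ^ (k - 1))"
        using n ab by (intro mult_mono iffD2[OF exp_le_cancel_iff] power_mono) auto
      also have "\<dots> \<le> s / 2 * exp (\<alpha> / \<sigma> * y N ^ k)"
        using elim(5) assms(6) by (simp del: power_Suc)
      also have "exp (\<alpha> / \<sigma> * y N ^ k) = real N powr \<alpha>"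
        using elim(1) assms(7) by (simp add: yk powr_def)
      also have "s / 2 * \<dots> \<le> s / 2 * M N"
        using s MN by (intro mult_left_mono) auto
      finally have "real n / M N \<le> s / 2 * exp (- (a * real n ^ (k - 1)))"
        using MN by (simp add: exp_minus field_simps)
      also have "exp (- (a * real n ^ (k - 1))) = t ^ (n ^ (k - 1))"
        by (simp add: t_eq mult.commute flip: exp_of_nat_mult)
      \<comment> \<open>The index k - 1 is the worst case, because t < 1 and n^j \<le> n^(k -
        1).\<close>
      also have "s / 2 * \<dots> \<le> s / 2 * t ^ (n ^ j)"
        using s t n that by (intro mult_left_mono power_decreasing power_increasing) auto
      finally show ?thesis by simp
    qed
    show ?case
    proof (intro allI impI)
      fix A :: "(nat \<Rightarrow> nat) \<Rightarrow> nat set"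
      assume A: "\<forall>m \<in> {1..k} \<rightarrow>\<^sub>E {1..M N}. A m \<subseteq> {1..N} \<and> real (card (A m)) \<ge> \<delta> * real N"
      have "t * (1 + s) * real (card {1..M N}) ^ k * card {1..N}
          = (\<Sum>m\<in>{1..k} \<rightarrow>\<^sub>E {1..M N}. \<delta> * real N)"
        by (simp add: s card_PiE)
      also have "\<dots> \<le> (\<Sum>m\<in>{1..k} \<rightarrow>\<^sub>E {1..M N}. real (card {x\<in>{1..N}. x \<in> A m}))"
      proof (rule sum_mono)
        fix m assume m: "m \<in> {1..k} \<rightarrow>\<^sub>E {1..M N}"
        then have "{x\<in>{1..N}. x \<in> A m} = A m" using A by blast
        then show "\<delta> * real N \<le> real (card {x\<in>{1..N}. x \<in> A m})" using A m by simp
      qed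
      finally obtain B where B: "\<forall>i\<in>{1..k}. B i \<subseteq> {1..M N} \<and> card (B i) = n"
          "t ^ (n ^ k) * card {1..N}
            \<le> card {x\<in>{1..N}. \<forall>m\<in>(\<Pi>\<^sub>E i\<in>{1..k}. B i). x \<in> A m}"
        using dense_hypergraph_common_points[OF _ _ _ _ n(3) s(1) t(1) _ small,
            of "{1..N}" k "\<lambda>m x. x \<in> A m"] elim(1) MN t by auto
      have sub: "(\<Pi>\<^sub>E i\<in>{1..k}. B i) \<subseteq> {1..k} \<rightarrow>\<^sub>E {1..M N}"
        using B by (intro PiE_mono) auto
      \<comment> \<open>An intersection over an empty index set would be \<open>UNIV\<close>;
        nonemptiness keeps it inside {1..N}.\<close>
      have "(\<Pi>\<^sub>E i\<in>{1..k}. B i) \<noteq> {}"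
        using B n by (fastforce simp: PiE_eq_empty_iff)
      then have Int: "{x\<in>{1..N}. \<forall>m\<in>(\<Pi>\<^sub>E i\<in>{1..k}. B i). x \<in> A m}
          = (\<Inter>m \<in> (\<Pi>\<^sub>E i\<in>{1..k}. B i). A m)"
        using A sub by blast
      \<comment> \<open>The bound is compared on the logarithmic scale: t^(n^k) = exp (- a n^k), and
        a n^k is at most b \<sigma> ln N.\<close>
      have "a * real n ^ k \<le> a * (y N + 1) ^ k"
        using n ab by (intro mult_left_mono power_mono) auto
      also have "\<dots> \<le> b * (\<sigma> * ln (real N))" using elim(4) by (simp add: yk)
      finally have "exp (ln (real N) - \<sigma> * b * ln (real N)) \<le> exp (ln (real N) - a * real n ^ k)"
        by (simp add: mult_ac)
      also have "\<dots> = t ^ (n ^ k) * real N"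
        using elim(1) by (simp add: t_eq exp_diff exp_minus field_simps flip: exp_of_nat_mult)
      finally have "real N powr (1 - \<sigma> * b) \<le> t ^ (n ^ k) * real N"
        using elim(1) by (simp add: powr_def algebra_simps)
      with B n Int show "\<exists>B. (\<forall>i\<in>{1..k}. B i \<subseteq> {1..M N} \<and> real (card (B i)) \<ge> y N) \<and>
          real (card (\<Inter>m \<in> (\<Pi>\<^sub>E i\<in>{1..k}. B i). A m)) \<ge> real N powr (1 - \<sigma> * b)"
        by (intro exI[of _ B]) auto
    qed
  qed
  then obtain N0 where "\<forall>N\<ge>N0. \<forall>A :: (nat \<Rightarrow> nat) \<Rightarrow> nat set.
    (\<forall>m \<in> {1..k} \<rightarrow>\<^sub>E {1..M N}. A m \<subseteq> {1..N} \<and> real (card (A m)) \<ge> \<delta> * real N) \<longrightarrow>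
    (\<exists>B :: nat \<Rightarrow> nat set. (\<forall>i \<in> {1..k}. B i \<subseteq> {1..M N} \<and> real (card (B i)) \<ge> y N) \<and>
      real (card (\<Inter>m \<in> (\<Pi>\<^sub>E i\<in>{1..k}. B i). A m)) \<ge> real N powr (1 - \<sigma> * b))"
    unfolding eventually_sequentially by blast
  then show ?thesis
    unfolding y_def b_def by (intro exI[of _ "max 1 N0"]) simp
qed

end
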